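(* For any connected $B\subset\mathcal{H}$ and any oriented nearest-neighbor edge $\vec e=x\to y$ with $x\in B$ and $y\in\mathcal{H}\setminus B$, there is a finite $H_B(\vec e)$ such that $$\lim_{N\to\infty}H_{B,N}(\vec e)=H_B(\vec e).$$
   Context: $\mathcal{H}=\{(x_1,x_2)\in\mathbb{Z}^2: x_2\ge 0\}$; $L_n=\{(k,n):k\in\mathbb{Z}\}$ for integers $n\ge 0$. Connectedness is with respect to nearest-neighbor adjacency in $\mathbb{Z}^2$. $(S_n)_{n\ge 0}$ is simple random walk on $\mathbb{Z}^2$, $P_z$ is its law when $S_0=z$, and for $A\subset\mathbb{Z}^2$, $\bar\tau_A=\min\{n\ge 0:S_n\in A\}$. For $B$ and $\vec e=x\to y$ as in the claim and an integer $N\geq 1$, $$H_{B,N}(\vec e)=\sum_{z\in L_N\setminus B}P_z\big(S_{\bar\tau_{B\cup L_0}}=x,\ S_{\bar\tau_{B\cup L_0}-1}=y\big).$$ *)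

theory Defs
  imports "HOL-Probability.Probability"
begin

type_synonym point = "int \<times> int"

definition half_plane :: "point set" where
  "half_plane = {p. snd p \<ge> 0}"

definition level :: "nat \<Rightarrow> point set" where
  "level n = {p. snd p = int n}"

definition adjacent :: "point \<Rightarrow> point \<Rightarrow> bool" where
  "adjacent p q \<longleftrightarrow> \<bar>fst p - fst q\<bar> + \<bar>snd p - snd q\<bar> = 1"

definition lattice_connected :: "point set \<Rightarrow> bool" where
  "lattice_connected A \<longleftrightarrow>
     (\<forall>p\<in>A. \<forall>q\<in>A. (p, q) \<in> {(u, v). u \<in> A \<and> v \<in> A \<and> adjacent u v}\<^sup>*)"

definition srw_step :: "point pmf" where
  "srw_step = pmf_of_set {(1, 0), (-1, 0), (0, 1), (0, -1)}"

text \<open>The law of the walk started at \<open>z\<close>, as a measure on path space.\<close>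

definition srw :: "point \<Rightarrow> (nat \<Rightarrow> point) measure" where
  "srw z = distr (\<Pi>\<^sub>M i\<in>(UNIV :: nat set). measure_pmf srw_step)
                 (\<Pi>\<^sub>M i\<in>(UNIV :: nat set). count_space UNIV)
                 (\<lambda>\<xi> n. z + (\<Sum>i<n. \<xi> i))"

text \<open>The value is \<open>\<infinity>\<close> if the path never visits \<open>A\<close>.\<close>

definition hitting_time :: "point set \<Rightarrow> (nat \<Rightarrow> point) \<Rightarrow> enat" where
  "hitting_time A S = (INF n\<in>{n. S n \<in> A}. enat n)"

text \<open>
  The path hits \<open>A\<close> for the first time at \<open>x\<close>, coming from \<open>y\<close>. Writing the hitting time as
  \<open>Suc n\<close> requires it to be finite and positive, so that the time one step earlier makes sense.
\<close>

definition hits_through :: "point set \<Rightarrow> point \<Rightarrow> point \<Rightarrow> (nat \<Rightarrow> point) set" where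
  "hits_through A x y =
     {S. \<exists>n. hitting_time A S = enat (Suc n) \<and> S (Suc n) = x \<and> S n = y}"

text \<open>
  The sum ranges over an infinite set and is taken in the extended nonnegative reals,
  so no summability is presupposed.
\<close>

definition edge_harmonic :: "point set \<Rightarrow> nat \<Rightarrow> point \<Rightarrow> point \<Rightarrow> ennreal" where
  "edge_harmonic B N x y =
     (\<Sum>\<^sub>\<infinity>z\<in>level N - B. emeasure (srw z) (hits_through (B \<union> level 0) x y))"

lemma sets_srw [measurable_cong]:
  "sets (srw z) = sets (\<Pi>\<^sub>M i\<in>(UNIV :: nat set). count_space UNIV)"
  by (simp add: srw_def)

lemma space_srw [simp]: "space (srw z) = UNIV"
  by (simp add: srw_def space_PiM)

lemma walk_measurable:
  "(\<lambda>\<xi> n. z + (\<Sum>i<n. \<xi> i)) \<in> (\<Pi>\<^sub>M i\<in>(UNIV :: nat set). measure_pmf srw_step)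
     \<rightarrow>\<^sub>M (\<Pi>\<^sub>M i\<in>(UNIV :: nat set). count_space (UNIV :: point set))"
proof (rule measurable_PiM_single')
  fix n :: nat
  let ?M = "\<Pi>\<^sub>M i\<in>(UNIV :: nat set). measure_pmf srw_step"
  show "(\<lambda>\<xi>. z + (\<Sum>i<n. \<xi> i)) \<in> ?M \<rightarrow>\<^sub>M count_space UNIV"
  proof (induction n)
    case (Suc n)
    have c: "(\<lambda>\<xi>. \<xi> n) \<in> ?M \<rightarrow>\<^sub>M count_space UNIV"
      using measurable_component_singleton[of n UNIV "\<lambda>_. measure_pmf srw_step"]
      by (simp cong: measurable_cong_sets)
    have "(\<lambda>\<xi>. (z + (\<Sum>i<n. \<xi> i)) + \<xi> n) \<in> ?M \<rightarrow>\<^sub>M count_space UNIV"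
      by (rule measurable_compose_countable[OF _ Suc.IH])
         (rule measurable_compose[OF c], simp)
    then show ?case by (simp add: add.assoc)
  qed simp
qed auto

lemma prob_space_srw: "prob_space (srw z)"
proof -
  interpret product_prob_space "\<lambda>_. measure_pmf srw_step" "UNIV :: nat set"
    by unfold_locales
  show ?thesis
    unfolding srw_def by (rule prob_space_distr[OF walk_measurable])
qed

lemma hitting_time_eq_enat_iff:
  "hitting_time A S = enat n \<longleftrightarrow> S n \<in> A \<and> (\<forall>m<n. S m \<notin> A)"
proof
  assume h: "hitting_time A S = enat n"
  have ne: "enat ` {n. S n \<in> A} \<noteq> {}"
    using h by (metis hitting_time_def Inf_empty enat.distinct(1) top_enat_def)
  have "Inf (enat ` {n. S n \<in> A}) \<in> enat ` {n. S n \<in> A}"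
    using ne by (auto simp: Inf_enat_def intro: LeastI)
  then have "S n \<in> A" using h by (auto simp: hitting_time_def)
  moreover have "S m \<notin> A" if "m < n" for m
    using that h INF_lower[of m "{n. S n \<in> A}" enat] by (force simp: hitting_time_def)
  ultimately show "S n \<in> A \<and> (\<forall>m<n. S m \<notin> A)" by blast
next
  assume "S n \<in> A \<and> (\<forall>m<n. S m \<notin> A)"
  then show "hitting_time A S = enat n"
    unfolding hitting_time_def
    by (intro antisym INF_lower INF_greatest) (auto simp: not_less[symmetric])
qed

lemma hits_through_measurable: "hits_through A x y \<in> sets (srw z)"
proof -
  have [measurable]: "(\<lambda>S. S n) \<in> srw z \<rightarrow>\<^sub>M count_space UNIV" for n
    unfolding measurable_cong_sets[OF sets_srw refl]
    by (rule measurable_component_singleton) simp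
  have "{S \<in> space (srw z). \<exists>n. (S (Suc n) \<in> A \<and> (\<forall>m<Suc n. S m \<notin> A)) \<and>
      S (Suc n) = x \<and> S n = y} \<in> sets (srw z)"
    by measurable
  then show ?thesis
    by (simp add: hits_through_def hitting_time_eq_enat_iff)
qed

end

theory Submission imports Defs begin

text \<open>
  By time reversal, the sum over starting points on level \<open>N\<close> is a quarter of the expected number
  of visits to level \<open>N\<close> by a walk from \<open>y\<close> before it hits \<open>A = B \<union> L\<^sub>0\<close>. The function
  \<open>g\<^sub>N(w) = min(w\<^sub>2, N)\<close> is harmonic except on level \<open>N\<close>, where its mean over neighbours drops by
  \<open>1/4\<close>; hence a quarter of the number of visits expected before time \<open>n\<close> is \<open>g\<^sub>N(y)\<close> minus the
  expectation of \<open>g\<^sub>N\<close> at the stopped walk at time \<open>n\<close>. For \<open>N \<ge> y\<^sub>2\<close> the first term is \<open>y\<^sub>2\<close> and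
  the second one is nonnegative and increasing in \<open>N\<close>. So the sequence is eventually decreasing and
  bounded by \<open>y\<^sub>2\<close>.
\<close>

section \<open>Countable sums and independence in product measures\<close>

lemma infsum_ennreal_eq_nn_integral:
  fixes f :: "'a \<Rightarrow> ennreal"
  assumes "countable A"
  shows "infsum f A = (\<integral>\<^sup>+z. f z \<partial>count_space A)"
proof (cases "finite A")
  case True
  then show ?thesis
    by (simp add: nn_integral_count_space_finite)
next
  case False
  define g where "g = from_nat_into A"
  have g: "bij_betw g UNIV A"
    unfolding g_def by (rule bij_betw_from_nat_into[OF assms False])
  have "infsum f A = infsum (\<lambda>n. f (g n)) UNIV"
    by (rule infsum_reindex_bij_betw[OF g, symmetric])
  also have "\<dots> = (\<Sum>n. f (g n))"
    by (rule sums_unique, rule has_sum_imp_sums, rule has_sum_infsum)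
       (simp add: nonneg_summable_on_complete)
  also have "\<dots> = (\<integral>\<^sup>+n. f (g n) \<partial>count_space UNIV)"
    by (rule nn_integral_count_space_nat[symmetric])
  also have "\<dots> = (\<integral>\<^sup>+z. f z \<partial>count_space A)"
    by (rule nn_integral_bij_count_space[OF g])
  finally show ?thesis .
qed

text \<open>\<open>comb_seq n\<close> splices two independent sequences at time \<open>n\<close> and
  preserves the product measure; \<open>F\<close> sees only the first one, and coordinate
  \<open>n\<close> is the start of the second.\<close>

lemma emeasure_PiM_past_next:
  fixes p :: "'a pmf"
  defines "P \<equiv> \<Pi>\<^sub>M i\<in>(UNIV :: nat set). measure_pmf p"
  assumes F: "F \<in> sets P"
    and past: "\<And>\<omega> \<omega>'. (\<And>i. i < n \<Longrightarrow> \<omega> i = \<omega>' i) \<Longrightarrow> \<omega> \<in> F \<Longrightarrow> \<omega>' \<in> F"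
  shows "emeasure P (F \<inter> {\<omega>. \<omega> n = e}) = emeasure P F * pmf p e"
proof -
  interpret sequence_space "measure_pmf p" by unfold_locales
  have sp: "space P = UNIV"
    by (simp add: P_def space_PiM)
  have single: "{\<omega>. \<omega> i = e} \<in> sets P" for i
  proof -
    have "(\<lambda>\<omega>. \<omega> i) \<in> P \<rightarrow>\<^sub>M measure_pmf p"
      unfolding P_def by (rule measurable_component_singleton) simp
    from measurable_sets[OF this, of "{e}"] show ?thesis
      by (simp add: sp vimage_def)
  qed
  have m: "(\<lambda>(\<omega>, \<omega>'). comb_seq n \<omega> \<omega>') \<in> P \<Otimes>\<^sub>M P \<rightarrow>\<^sub>M P"
    unfolding P_def by (rule measurable_comb_seq)
  have comb: "distr (P \<Otimes>\<^sub>M P) P (\<lambda>(\<omega>, \<omega>'). comb_seq n \<omega> \<omega>') = P"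
    unfolding P_def by (rule PiM_comb_seq)
  have iff: "comb_seq n \<omega> \<omega>' \<in> F \<longleftrightarrow> \<omega> \<in> F" for \<omega> \<omega>'
    using past[of "comb_seq n \<omega> \<omega>'" \<omega>] past[of \<omega> "comb_seq n \<omega> \<omega>'"]
    by (auto simp: comb_seq_less)
  have nth: "comb_seq n \<omega> \<omega>' n = \<omega>' 0" for \<omega> \<omega>' :: "nat \<Rightarrow> 'a"
    using comb_seq_add[of n \<omega> \<omega>' 0] by simp
  have "emeasure P (F \<inter> {\<omega>. \<omega> n = e}) =
      emeasure (distr (P \<Otimes>\<^sub>M P) P (\<lambda>(\<omega>, \<omega>'). comb_seq n \<omega> \<omega>')) (F \<inter> {\<omega>. \<omega> n = e})"
    by (simp only: comb)
  also have "\<dots> = emeasure (P \<Otimes>\<^sub>M P)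
      ((\<lambda>(\<omega>, \<omega>'). comb_seq n \<omega> \<omega>') -` (F \<inter> {\<omega>. \<omega> n = e}) \<inter> space (P \<Otimes>\<^sub>M P))"
    using F single by (intro emeasure_distr m) auto
  also have "(\<lambda>(\<omega>, \<omega>'). comb_seq n \<omega> \<omega>') -` (F \<inter> {\<omega>. \<omega> n = e}) \<inter> space (P \<Otimes>\<^sub>M P) =
      F \<times> {\<omega>. \<omega> 0 = e}"
    by (auto simp: space_pair_measure sp iff nth)
  also have "emeasure (P \<Otimes>\<^sub>M P) \<dots> = emeasure P F * emeasure P {\<omega>. \<omega> 0 = e}"
    using F single unfolding P_def by (intro P.emeasure_pair_measure_Times)
  also have "emeasure P {\<omega>. \<omega> 0 = e} = pmf p e"
    using emeasure_PiM_Collect_single[of 0 "{e}"]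
    by (simp add: P_def space_PiM emeasure_pmf_single)
  finally show ?thesis .
qed

section \<open>Killed and stopped walks on the lattice\<close>

definition step_average :: "(point \<Rightarrow> real) \<Rightarrow> point \<Rightarrow> real" where
  "step_average f w = (f (w - (1, 0)) + f (w - (-1, 0)) + f (w - (0, 1)) + f (w - (0, -1))) / 4"

text \<open>The expectation of \<open>f (S\<^sub>n)\<close> on the event that a walk from \<open>w\<close> avoids \<open>A\<close> up to time \<open>n\<close>.\<close>

primrec killed :: "point set \<Rightarrow> (point \<Rightarrow> real) \<Rightarrow> nat \<Rightarrow> point \<Rightarrow> real" where
  "killed A f 0 w = (if w \<in> A then 0 else f w)"
| "killed A f (Suc n) w = (if w \<in> A then 0 else step_average (killed A f n) w)"

text \<open>The expectation of \<open>g\<close> at time \<open>n\<close> for a walk from \<open>w\<close> frozen when it enters \<open>A\<close>.\<close>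

primrec stopped :: "point set \<Rightarrow> (point \<Rightarrow> real) \<Rightarrow> nat \<Rightarrow> point \<Rightarrow> real" where
  "stopped A g 0 w = g w"
| "stopped A g (Suc n) w = (if w \<in> A then g w else step_average (stopped A g n) w)"

lemma killed_nonneg: "(\<And>v. f v \<ge> 0) \<Longrightarrow> killed A f n w \<ge> 0"
  by (induction n arbitrary: w) (auto simp: step_average_def)

lemma stopped_mono: "(\<And>v. f v \<le> g v) \<Longrightarrow> stopped A f n w \<le> stopped A g n w"
  by (induction n arbitrary: w) (auto simp: step_average_def intro!: divide_right_mono add_mono)

text \<open>\<open>capped_height\<close> is negative below level 0, but a walk frozen on level 0
  cannot leave the half-plane, since a step lowers the height by at most one.\<close>

lemma stopped_nonneg:
  assumes "level 0 \<subseteq> A" "\<And>v. v \<in> half_plane \<Longrightarrow> g v \<ge> 0" "w \<in> half_plane"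
  shows "stopped A g n w \<ge> 0"
  using assms(3)
proof (induction n arbitrary: w)
  case 0
  then show ?case using assms(2) by simp
next
  case (Suc n)
  show ?case
  proof (cases "w \<in> A")
    case True
    then show ?thesis using Suc.prems assms(2) by simp
  next
    case False
    then have "snd w \<noteq> 0" using assms(1) by (auto simp: level_def)
    with Suc.prems have "w - d \<in> half_plane" if "snd d \<le> 1" for d
      using that by (auto simp: half_plane_def)
    then show ?thesis using False Suc.IH by (simp add: step_average_def)
  qed
qed

definition capped_height :: "nat \<Rightarrow> point \<Rightarrow> real" where
  "capped_height N w = min (real_of_int (snd w)) (real N)"

text \<open>At \<open>n = 0\<close> this is the discrete Laplacian of \<open>capped_height\<close>
  off \<open>A\<close>; linearity of \<open>step_average\<close> carries it to later times.\<close>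

lemma stopped_capped_height_Suc:
  "stopped A (capped_height N) (Suc n) w =
    stopped A (capped_height N) n w - killed A (indicator (level N)) n w / 4"
proof (induction n arbitrary: w)
  case 0
  show ?case
  proof (cases "snd w" "int N" rule: linorder_cases)
    case less
    \<comment> \<open>Integrality puts all four neighbours on one linear piece of the
      minimum.\<close>
    then have "snd w + 1 \<le> int N" by simp
    then have "real_of_int (snd w) + 1 \<le> real N" by linarith
    with less show ?thesis
      by (auto simp: step_average_def capped_height_def level_def)
  next
    case equal
    then have "real_of_int (snd w) = real N" by simp
    with equal show ?thesis
      by (auto simp: step_average_def capped_height_def level_def field_simps)
  next
    case greater
    then have "int N + 1 \<le> snd w" by simp
    then have "real N + 1 \<le> real_of_int (snd w)" by linarith
    with greater show ?thesis
      by (auto simp: step_average_def capped_height_def level_def)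
  qed
next
  case (Suc n)
  have "step_average (stopped A (capped_height N) (Suc n)) w =
      step_average (stopped A (capped_height N) n) w -
      step_average (killed A (indicator (level N)) n) w / 4"
    unfolding step_average_def Suc.IH by (simp add: field_simps)
  then show ?case by simp
qed

text \<open>The one-step identity telescopes; this is a discrete Dynkin formula.\<close>

lemma sum_killed_level:
  "(\<Sum>m<n. killed A (indicator (level N)) m w / 4) =
    capped_height N w - stopped A (capped_height N) n w"
  by (induction n) (simp_all only: sum.lessThan_Suc stopped_capped_height_Suc, simp_all)

section \<open>Path events and their probabilities\<close>

definition avoiding :: "point set \<Rightarrow> nat \<Rightarrow> point \<Rightarrow> (nat \<Rightarrow> point) set" where
  "avoiding A n w = {S. (\<forall>m\<le>n. S m \<notin> A) \<and> S n = w}"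

lemma walk_coordinate_measurable [measurable]: "(\<lambda>S. S n) \<in> srw z \<rightarrow>\<^sub>M count_space UNIV"
  unfolding measurable_cong_sets[OF sets_srw refl]
  by (rule measurable_component_singleton) simp

lemma avoiding_measurable [measurable]: "avoiding A n w \<in> sets (srw z)"
proof -
  have "{S \<in> space (srw z). (\<forall>m\<le>n. S m \<notin> A) \<and> S n = w} \<in> sets (srw z)"
    by measurable
  then show ?thesis by (simp add: avoiding_def)
qed

lemma walk_at_measurable [measurable]: "{S. S n = w} \<in> sets (srw z)"
proof -
  have "{S \<in> space (srw z). S n = w} \<in> sets (srw z)"
    by measurable
  then show ?thesis by simp
qed

text \<open>Markov property: pulled back to increments, \<open>avoiding A n w\<close> depends only
  on those before index \<open>n\<close>, while the next step is increment \<open>n\<close>.\<close>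

lemma emeasure_avoiding_step:
  "emeasure (srw z) (avoiding A n w \<inter> {S. S (Suc n) = w + e}) =
    emeasure (srw z) (avoiding A n w) * pmf srw_step e"
proof -
  let ?P = "\<Pi>\<^sub>M i\<in>(UNIV :: nat set). measure_pmf srw_step"
  let ?W = "\<lambda>\<xi> n. z + (\<Sum>i<n. \<xi> i)"
  have sp: "space ?P = UNIV" by (simp add: space_PiM)
  have em: "emeasure (srw z) X = emeasure ?P (?W -` X)" if "X \<in> sets (srw z)" for X
    using emeasure_distr[OF walk_measurable, of X z] that
    by (simp add: srw_def[symmetric] sets_srw sp)
  have "?W -` (avoiding A n w \<inter> {S. S (Suc n) = w + e}) = ?W -` avoiding A n w \<inter> {\<xi>. \<xi> n = e}"
    by (auto simp: avoiding_def add.assoc[symmetric])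
  moreover have "emeasure ?P (?W -` avoiding A n w \<inter> {\<xi>. \<xi> n = e}) =
      emeasure ?P (?W -` avoiding A n w) * pmf srw_step e"
  proof (rule emeasure_PiM_past_next)
    show "?W -` avoiding A n w \<in> sets ?P"
      using measurable_sets[OF walk_measurable, of "avoiding A n w" z] avoiding_measurable[of A n w z]
      by (simp add: sets_srw sp)
  next
    fix \<omega> \<omega>' :: "nat \<Rightarrow> point"
    assume eq: "\<And>i. i < n \<Longrightarrow> \<omega> i = \<omega>' i" and mem: "\<omega> \<in> ?W -` avoiding A n w"
    have "?W \<omega> m = ?W \<omega>' m" if "m \<le> n" for m
      using that eq by (auto intro!: sum.cong)
    with mem show "\<omega>' \<in> ?W -` avoiding A n w"
      by (simp add: avoiding_def)
  qed
  ultimately show ?thesis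
    by (simp add: em)
qed

lemma nn_integral_srw_step:
  "(\<integral>\<^sup>+e. f e \<partial>measure_pmf srw_step) = (f (1, 0) + f (-1, 0) + f (0, 1) + f (0, -1)) / 4"
  unfolding srw_step_def by (subst nn_integral_pmf_of_set) (simp_all add: add.assoc)

text \<open>Decomposition by the last step, which is why \<open>step_average\<close> subtracts
  steps. The step set is symmetric, so the same recursion describes a walk started from
  \<open>w\<close>.\<close>

lemma emeasure_avoiding_Suc:
  assumes "w \<notin> A"
  shows "emeasure (srw z) (avoiding A (Suc n) w) =
    (\<integral>\<^sup>+e. emeasure (srw z) (avoiding A n (w - e)) \<partial>measure_pmf srw_step)"
proof -
  have "avoiding A (Suc n) w = (\<Union>e. avoiding A n (w - e) \<inter> {S. S (Suc n) = w})"
  proof (intro set_eqI iffI)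
    fix S assume "S \<in> avoiding A (Suc n) w"
    then have "S \<in> avoiding A n (w - (w - S n)) \<inter> {S. S (Suc n) = w}"
      by (auto simp: avoiding_def)
    then show "S \<in> (\<Union>e. avoiding A n (w - e) \<inter> {S. S (Suc n) = w})" by blast
  qed (use assms in \<open>auto simp: avoiding_def le_Suc_eq\<close>)
  also have "emeasure (srw z) \<dots> =
      (\<integral>\<^sup>+e. emeasure (srw z) (avoiding A n (w - e) \<inter> {S. S (Suc n) = w}) \<partial>count_space UNIV)"
    by (rule emeasure_UN_countable)
       (auto simp: disjoint_family_on_def avoiding_def[where n = n] intro: sets.Int)
  also have "\<dots> = (\<integral>\<^sup>+e. pmf srw_step e * emeasure (srw z) (avoiding A n (w - e)) \<partial>count_space UNIV)"
    using emeasure_avoiding_step[of z A n "w - e" e for e] by (simp add: mult.commute)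
  finally show ?thesis by (simp add: nn_integral_measure_pmf)
qed

text \<open>The recursion runs backwards from the endpoint \<open>w\<close>, so this also reverses the walk.\<close>

lemma emeasure_avoiding:
  "emeasure (srw z) (avoiding A n w) = ennreal (killed A (indicator {z}) n w)"
proof (induction n arbitrary: w)
  case 0
  have start: "AE S in srw z. S 0 = z"
    unfolding srw_def by (subst AE_distr_iff[OF walk_measurable])
      (use walk_at_measurable[of 0 z z] in \<open>auto simp: space_PiM sets_srw\<close>)
  have "emeasure (srw z) (avoiding A 0 w) =
      emeasure (srw z) (if z = w \<and> w \<notin> A then space (srw z) else {})"
  proof (rule emeasure_eq_AE)
    show "AE S in srw z. S \<in> avoiding A 0 w \<longleftrightarrow> S \<in> (if z = w \<and> w \<notin> A then space (srw z) else {})"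
      using start by eventually_elim (auto simp: avoiding_def)
    show "(if z = w \<and> w \<notin> A then space (srw z) else {}) \<in> sets (srw z)"
      by (simp del: space_srw)
  qed simp
  then show ?case
    using prob_space.emeasure_space_1[OF prob_space_srw] by auto
next
  case (Suc n)
  show ?case
  proof (cases "w \<in> A")
    case True
    then have "avoiding A (Suc n) w = {}" by (auto simp: avoiding_def)
    with True show ?thesis by simp
  next
    case False
    then show ?thesis
      by (simp add: emeasure_avoiding_Suc nn_integral_srw_step Suc.IH step_average_def
          killed_nonneg ennreal_plus[symmetric] divide_ennreal[of _ 4, symmetric] del: ennreal_plus)
  qed
qed

text \<open>\<open>killed\<close> is linear in its payoff, and the indicator of \<open>C\<close> is
  the sum of those of its points.\<close>

lemma nn_integral_killed_singleton:
  assumes "C \<inter> A = {}"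
  shows "(\<integral>\<^sup>+z. ennreal (killed A (indicator {z}) n w) \<partial>count_space C) =
    ennreal (killed A (indicator C) n w)"
proof (induction n arbitrary: w)
  case 0
  show ?case
  proof (cases "w \<in> C")
    case True
    then have "(\<integral>\<^sup>+z. ennreal (indicator {z} w) \<partial>count_space C) =
        (\<integral>\<^sup>+z. ennreal (indicator {w} z) \<partial>count_space C)"
      by (intro nn_integral_cong) (auto simp: indicator_def)
    also have "\<dots> = 1" using True by (simp add: ennreal_indicator)
    finally show ?thesis using True assms by auto
  next
    case False
    then have "(\<integral>\<^sup>+z. ennreal (indicator {z} w) \<partial>count_space C) = (\<integral>\<^sup>+z. 0 \<partial>count_space C)"
      by (intro nn_integral_cong) (auto simp: indicator_def)
    with False show ?thesis by auto
  qed
next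
  case (Suc n)
  then show ?case
    by (simp add: step_average_def killed_nonneg divide_ennreal[of _ 4, symmetric]
        nn_integral_divide nn_integral_add)
qed

lemma killed_cong: "(\<And>v. v \<notin> A \<Longrightarrow> f v = g v) \<Longrightarrow> killed A f n w = killed A g n w"
  by (induction n arbitrary: w) (auto simp: step_average_def)

section \<open>First entry through an edge, summed over times and starting points\<close>

lemma hits_through_eq_UN:
  assumes "x \<in> A"
  shows "hits_through A x y = (\<Union>n. avoiding A n y \<inter> {S. S (Suc n) = x})"
  using assms
  by (auto simp: hits_through_def hitting_time_eq_enat_iff avoiding_def less_Suc_eq_le)

text \<open>The events for different times of the final step are disjoint, and 1/4 is the
  probability of stepping from \<open>y\<close> to \<open>x\<close>.\<close>

lemma emeasure_hits_through:
  assumes "x \<in> A" "adjacent x y"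
  shows "emeasure (srw z) (hits_through A x y) = (\<Sum>n. ennreal (killed A (indicator {z}) n y / 4))"
proof -
  have "x - y \<in> {(1, 0), (-1, 0), (0, 1), (0, -1)}"
    using assms(2) by (cases x; cases y) (auto simp: adjacent_def)
  then have "pmf srw_step (x - y) = 1 / 4"
    by (simp add: srw_step_def)
  then have step: "emeasure (srw z) (avoiding A n y \<inter> {S. S (Suc n) = x}) =
      ennreal (killed A (indicator {z}) n y / 4)" for n
    using emeasure_avoiding_step[of z A n y "x - y"]
    by (simp add: emeasure_avoiding ennreal_mult[symmetric] killed_nonneg)
  \<comment> \<open>If the times differed, the path would be at \<open>x\<close>, a point of
    \<open>A\<close>, one step after the earlier time, yet avoid \<open>A\<close> up to the later
    one.\<close>
  have "m = n" if "S \<in> avoiding A n y \<inter> {S. S (Suc n) = x}"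
    "S \<in> avoiding A m y \<inter> {S. S (Suc m) = x}" for S m n
    using that assms(1) by (cases m n rule: linorder_cases) (auto simp: avoiding_def Suc_le_eq)
  then have "disjoint_family (\<lambda>n. avoiding A n y \<inter> {S. S (Suc n) = x})"
    unfolding disjoint_family_on_def by blast
  then have "(\<Sum>n. emeasure (srw z) (avoiding A n y \<inter> {S. S (Suc n) = x})) =
      emeasure (srw z) (\<Union>n. avoiding A n y \<inter> {S. S (Suc n) = x})"
    by (intro suminf_emeasure) auto
  then show ?thesis
    by (simp add: hits_through_eq_UN[OF assms(1)] step)
qed

lemma edge_harmonic_eq_suminf:
  assumes "x \<in> B" "adjacent x y" "N > 0"
  shows "edge_harmonic B N x y =
    (\<Sum>n. ennreal (killed (B \<union> level 0) (indicator (level N)) n y / 4))"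
proof -
  let ?A = "B \<union> level 0" and ?C = "level N - B"
  \<comment> \<open>Positivity of \<open>N\<close> keeps \<open>?C\<close> off level 0.\<close>
  have C: "?C \<inter> ?A = {}" using assms(3) by (auto simp: level_def)
  have "edge_harmonic B N x y =
      (\<integral>\<^sup>+z. (\<Sum>n. ennreal (killed ?A (indicator {z}) n y / 4)) \<partial>count_space ?C)"
    unfolding edge_harmonic_def using assms
    by (subst infsum_ennreal_eq_nn_integral) (auto simp: emeasure_hits_through)
  also have "\<dots> = (\<Sum>n. \<integral>\<^sup>+z. ennreal (killed ?A (indicator {z}) n y / 4) \<partial>count_space ?C)"
    by (rule nn_integral_suminf) simp
  also have "\<dots> = (\<Sum>n. ennreal (killed ?A (indicator ?C) n y / 4))"
    by (simp add: divide_ennreal[of _ 4, symmetric] killed_nonneg nn_integral_divide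
        nn_integral_killed_singleton[OF C])
  \<comment> \<open>The points of \<open>B\<close> on level \<open>N\<close> can be put back:
    \<open>killed\<close> ignores the payoff on \<open>?A\<close>.\<close>
  also have "\<dots> = (\<Sum>n. ennreal (killed ?A (indicator (level N)) n y / 4))"
    by (subst killed_cong[where g = "indicator (level N)"]) (auto simp: indicator_def)
  finally show ?thesis .
qed

theorem proposition1:
  fixes B :: "point set" and x y :: point
  assumes "B \<subseteq> half_plane"
    and "lattice_connected B"
    and "x \<in> B"
    and "y \<in> half_plane - B"
    and "adjacent x y"
  shows "\<exists>H :: ennreal. H < \<infinity> \<and> (\<lambda>N. edge_harmonic B N x y) \<longlonglongrightarrow> H"
proof -
  let ?A = "B \<union> level 0"
  let ?s = "\<lambda>N n. \<Sum>m<n. ennreal (killed ?A (indicator (level N)) m y / 4)"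
  \<comment> \<open>From \<open>N0\<close> on, the cap is inactive at \<open>y\<close> and the level
    is positive.\<close>
  define N0 where "N0 = Suc (nat (snd y))"
  have y: "y \<in> half_plane" using assms(4) by simp
  have height: "capped_height N y = snd y" if "N \<ge> N0" for N
    using that y by (auto simp: N0_def capped_height_def half_plane_def min_def)
  have s: "?s N n = ennreal (snd y - stopped ?A (capped_height N) n y)" if "N \<ge> N0" for N n
    using sum_killed_level[of ?A N y n] height[OF that] by (simp add: sum_ennreal killed_nonneg)
  have bound: "?s N n \<le> ennreal (snd y)" if "N \<ge> N0" for N n
    unfolding s[OF that]
    by (intro ennreal_leI)
       (use stopped_nonneg[of ?A "capped_height N" y n] y in
         \<open>simp add: capped_height_def half_plane_def\<close>)
  \<comment> \<open>Raising the cap raises the subtracted term and leaves the height of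
    \<open>y\<close> unchanged.\<close>
  have mono: "?s M n \<le> ?s N n" if "N0 \<le> N" "N \<le> M" for M N n
  proof -
    have "stopped ?A (capped_height N) n y \<le> stopped ?A (capped_height M) n y"
      by (rule stopped_mono) (use that in \<open>auto simp: capped_height_def\<close>)
    then show ?thesis
      using that s[of N n] s[of M n] by (simp add: ennreal_leI)
  qed
  have eq: "edge_harmonic B N x y = (SUP n. ?s N n)" if "N \<ge> N0" for N
    using that edge_harmonic_eq_suminf[OF assms(3,5), of N]
    by (simp add: N0_def suminf_eq_SUP)
  \<comment> \<open>Monotonicity is established only from \<open>N0\<close> on;
    \<open>LIMSEQ_offset\<close> later removes the shift.\<close>
  let ?f = "\<lambda>N. edge_harmonic B (N + N0) x y"
  have "decseq ?f"
    by (auto simp: decseq_def eq intro!: SUP_mono' mono)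
  then have "?f \<longlonglongrightarrow> (INF N. ?f N)"
    by (rule LIMSEQ_INF)
  then have "(\<lambda>N. edge_harmonic B N x y) \<longlonglongrightarrow> (INF N. ?f N)"
    by (rule LIMSEQ_offset)
  moreover have "(INF N. ?f N) < \<infinity>"
  proof -
    have "(INF N. ?f N) \<le> ?f 0" by (rule INF_lower) simp
    also have "\<dots> \<le> ennreal (snd y)"
      unfolding eq[OF le_add2] by (intro SUP_least bound) simp
    also have "\<dots> < \<infinity>" by simp
    finally show ?thesis .
  qed
  ultimately show ?thesis by blast
qed

end
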